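(* Let $n\ge 3$. Let $\mathcal F=\{f_i\}_{i=1}^k$ be a family without repeated vectors in $\mathbb Z_2^n$ and let $\mathcal G=\mathbb Z_2^n\setminus\mathcal F$ be its set-theoretic complement. If $\mathcal F$ is a Parseval frame for $\mathbb Z_2^n$, then $\mathcal G$ is also a Parseval frame for $\mathbb Z_2^n$.
   Context: $\mathbb Z_2$ is the field with two elements. The dot product on $\mathbb Z_2^n$ is $(a,b)=\sum_{i=1}^n a_ib_i\in\mathbb Z_2$. A family $\{f_1,\dots,f_k\}$ of vectors in $\mathbb Z_2^n$ is a Parseval frame for $\mathbb Z_2^n$ if $x=\sum_{j=1}^k (x,f_j)f_j$ for all $x\in\mathbb Z_2^n$. A family without repeated vectors is identified with the set of its vectors, and a subset of $\mathbb Z_2^n$ is regarded as a family by enumerating its elements once each (the Parseval property does not depend on the enumeration). *)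

theory Defs
  imports "HOL-Analysis.Finite_Cartesian_Product" "HOL-Library.Z2"
begin

text \<open>The space of binary n-vectors is \<open>bit ^ 'n\<close>, where \<open>bit\<close> is the two-element field
  and \<open>n = CARD('n)\<close>.\<close>

definition dot :: "bit ^ 'n \<Rightarrow> bit ^ 'n \<Rightarrow> bit" where
  "dot a b = (\<Sum>i\<in>UNIV. a $ i * b $ i)"

text \<open>Only the values \<open>f 1, \<dots>, f k\<close> matter: they are the members of the family, possibly
  with repetitions.\<close>

definition parseval_frame :: "nat \<Rightarrow> (nat \<Rightarrow> bit ^ 'n) \<Rightarrow> bool" where
  "parseval_frame k f \<longleftrightarrow> (\<forall>x. x = (\<Sum>j = 1..k. dot x (f j) *s f j))"

text \<open>A set of vectors is regarded as a family by enumerating its elements once each. An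
  enumeration always exists, and by \<open>parseval_frame_set_iff\<close> the choice is immaterial.\<close>

definition parseval_frame_set :: "(bit ^ 'n) set \<Rightarrow> bool" where
  "parseval_frame_set S \<longleftrightarrow> (\<exists>m g. bij_betw g {1..m} S \<and> parseval_frame m g)"

lemma parseval_frame_set_iff:
  fixes S :: "(bit ^ 'n) set"
  assumes "bij_betw g {1..m} S"
  shows "parseval_frame_set S \<longleftrightarrow> parseval_frame m g"
proof -
  have "parseval_frame l h \<longleftrightarrow> (\<forall>x. x = (\<Sum>v\<in>S. dot x v *s v))"
    if "bij_betw h {1..l} S" for l and h :: "nat \<Rightarrow> bit ^ 'n"
    unfolding parseval_frame_def
    using sum.reindex_bij_betw[OF that, of "\<lambda>v. dot x v *s v" for x] by simp
  with assms show ?thesis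
    unfolding parseval_frame_set_def by blast
qed

end

theory Submission
  imports Defs
begin

text \<open>The frame operator of the whole space vanishes: its \<open>(i, j)\<close> entry is the sum of
  \<open>v $ i * v $ j\<close> over all \<open>v\<close>, and for dimension at least 3 flipping a third coordinate pairs
  off equal terms, which cancel in characteristic 2. Hence the frame operators of a set and of
  its complement agree.\<close>

text \<open>Makes \<open>bit ^ 'n\<close> a finite type, so that sums over \<open>UNIV\<close> are
  genuine sums and complements can be enumerated.\<close>

instance bit :: finite
proof
  have "(UNIV :: bit set) = {0, 1}"
    using bit_not_zero_iff by blast
  then show "finite (UNIV :: bit set)"
    by (metis finite.emptyI finite.insertI)
qed

lemma bit_vec_add_self: "v + v = (0 :: bit ^ 'n)"
  by (simp add: vec_eq_iff)

text \<open>Adding \<open>axis l 1\<close> is an involution exchanging the vectors with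
  \<open>l\<close>-th coordinate 0 and those with 1, so the two halves have equal sums.\<close>

lemma sum_flip_coordinate_eq_0:
  fixes h :: "bit ^ 'n \<Rightarrow> bit"
  assumes inv: "\<And>v. h (v + axis l 1) = h v"
  shows "(\<Sum>v\<in>UNIV. h v) = 0"
proof -
  let ?Z = "{v :: bit ^ 'n. v $ l = 0}"
  have "bij_betw (\<lambda>v. v + axis l 1) ?Z (- ?Z)"
    by (rule bij_betw_byWitness[where f' = "\<lambda>v. v + axis l 1"])
      (auto simp: add.assoc bit_vec_add_self)
  then have "sum h (- ?Z) = sum h ?Z"
    using sum.reindex_bij_betw[of "\<lambda>v. v + axis l 1" ?Z "- ?Z" h] by (simp add: inv)
  moreover have "sum h UNIV = sum h ?Z + sum h (- ?Z)"
    using sum.subset_diff[of ?Z UNIV h]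
    by (simp add: Compl_eq_Diff_UNIV add.commute del: add_bit_eq_xor)
  ultimately show ?thesis
    by simp
qed

lemma frame_operator_UNIV_eq_0:
  fixes x :: "bit ^ 'n"
  assumes "CARD('n) \<ge> 3"
  shows "(\<Sum>v\<in>UNIV. dot x v *s v) = 0"
proof -
  have entry: "(\<Sum>v\<in>(UNIV :: (bit ^ 'n) set). v $ j * v $ i) = 0" for i j :: 'n
  proof -
    \<comment> \<open>At most two coordinates occur in the summand (one if \<open>i = j\<close>), so
      some coordinate \<open>l\<close> can be flipped without changing it.\<close>
    have "card {i, j} < CARD('n)"
      using assms card_insert_le_m1[of 2 "{j}" i] by simp
    then obtain l where "l \<notin> {i, j}"
      by (metis UNIV_I card_mono finite.emptyI finite.insertI linorder_not_less subsetI)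
    then show ?thesis
      by (intro sum_flip_coordinate_eq_0[of _ l]) (auto simp: axis_def)
  qed
  have "(\<Sum>v\<in>UNIV. dot x v *s v) $ i = 0" for i
  proof -
    \<comment> \<open>Expanding \<open>dot\<close> and swapping the sums makes the coefficient of
      \<open>x $ j\<close> the matrix entry handled by \<open>entry\<close>.\<close>
    have "(\<Sum>v\<in>UNIV. dot x v *s v) $ i = (\<Sum>v\<in>UNIV. \<Sum>j\<in>UNIV. x $ j * (v $ j * v $ i))"
      by (simp add: dot_def sum_distrib_right mult.assoc del: mult_bit_eq_and add_bit_eq_xor)
    also have "\<dots> = (\<Sum>j\<in>UNIV. x $ j * (\<Sum>v\<in>UNIV. v $ j * v $ i))"
      by (subst sum.swap) (simp add: sum_distrib_left del: mult_bit_eq_and add_bit_eq_xor)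
    finally show ?thesis
      by (simp add: entry del: mult_bit_eq_and add_bit_eq_xor)
  qed
  then show ?thesis
    by (simp add: vec_eq_iff)
qed

theorem theorem4p13:
  fixes f :: "nat \<Rightarrow> bit ^ 'n" and k :: nat
  assumes "CARD('n) \<ge> 3"
    and "inj_on f {1..k}"
    and "parseval_frame k f"
  shows "parseval_frame_set (UNIV - f ` {1..k})"
proof -
  let ?F = "f ` {1..k}"
  have "finite (UNIV - ?F)"
    by simp
  then obtain g where g: "bij_betw g {1..card (UNIV - ?F)} (UNIV - ?F)"
    using ex_bij_betw_nat_finite_1 by blast
  have "x = (\<Sum>j = 1..card (UNIV - ?F). dot x (g j) *s g j)" for x
  proof -
    have "(\<Sum>v\<in>?F. dot x v *s v) = x"
      using assms(3) unfolding sum.reindex[OF assms(2)] parseval_frame_def comp_def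
      by (rule allE) (rule sym)
    moreover have "(\<Sum>v\<in>UNIV - ?F. dot x v *s v) + (\<Sum>v\<in>?F. dot x v *s v) = 0"
      using sum.subset_diff[of ?F UNIV "\<lambda>v. dot x v *s v"]
      by (simp add: frame_operator_UNIV_eq_0[OF assms(1)])
    \<comment> \<open>In characteristic 2 the zero can be written as \<open>x + x\<close>;
      cancelling \<open>x\<close> then isolates the sum over the complement.\<close>
    ultimately have "(\<Sum>v\<in>UNIV - ?F. dot x v *s v) + x = x + x"
      by (simp add: bit_vec_add_self)
    then have "(\<Sum>v\<in>UNIV - ?F. dot x v *s v) = x"
      by (rule add_right_imp_eq)
    then show ?thesis
      unfolding sum.reindex_bij_betw[OF g, of "\<lambda>v. dot x v *s v"] by (rule sym)
  qed
  with g show ?thesis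
    unfolding parseval_frame_set_def parseval_frame_def by blast
qed

end
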